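(* Let $X$ be a topological space and let $Y$ be a convex set in a topological vector space. Let $T\in KKM(Y,X)$ be compact. Let $P:X\to 2^{Y}$ be a nonempty-valued, lower semicontinuous correspondence and let $Q:Y\to 2^{Y}$ be open-valued, such that for each $x\in X$ there exists $y\in Y$ with $P(x)\cap Q(y)\neq\emptyset$. Then there exist an integer $n\ge 2$, points $y_1^{\ast},\dots,y_n^{\ast}\in Y$, a point $y^{\ast}\in\operatorname{co}\{y_1^{\ast},\dots,y_n^{\ast}\}$ and $x^{\ast}\in T(y^{\ast})$ such that $Q(y_i^{\ast})\cap P(x^{\ast})\neq\emptyset$ for each $i\in\{1,\dots,n\}$.
   Context: A correspondence $T:Y\to 2^{X}$ assigns to each $y\in Y$ a subset $T(y)\subset X$; $T(B)=\bigcup_{y\in B}T(y)$ for $B\subset Y$. $T$ is compact if $\overline{T(Y)}$ is a compact subset of $X$. $\operatorname{co}$ denotes the convex hull. Given $T,H:Y\to 2^{X}$, $H$ is a generalized KKM mapping w.r.t. $T$ if $T(\operatorname{co}B)\subset H(B)$ for each finite $B\subset Y$. $KKM(Y,X)$ is the set of $T:Y\to 2^{X}$ having the KKM property: for every $H:Y\to 2^{X}$ which is a generalized KKM mapping w.r.t. $T$, the family $\{\overline{H(y)}:y\in Y\}$ has the finite intersection property. $P:X\to 2^{Y}$ is lower semicontinuous if $\{x\in X:P(x)\cap V\neq\emptyset\}$ is open in $X$ for every open $V\subset Y$. *)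

theory Defs
  imports "HOL-Analysis.Analysis"
begin

text \<open>Neither the Hausdorff property nor local convexity is assumed.\<close>

class real_topological_vector = real_vector + topological_ab_group_add +
  assumes tendsto_scaleR_nhds:
    "((\<lambda>p. fst p *\<^sub>R snd p) \<longlongrightarrow> a *\<^sub>R b) (nhds a \<times>\<^sub>F nhds b)"

instance real_normed_vector \<subseteq> real_topological_vector
proof
  fix a :: real and b :: 'a
  show "((\<lambda>p. fst p *\<^sub>R snd p) \<longlongrightarrow> a *\<^sub>R b) (nhds a \<times>\<^sub>F nhds b)"
    by (intro tendsto_scaleR filterlim_fst filterlim_snd)
qed

text \<open>
  A correspondence from \<open>Y\<close> to the subsets of \<open>X\<close> is a set-valued function on the
  ambient type of which only the values at points of \<open>Y\<close> matter; the space \<open>X\<close> is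
  the universe of a type, so it is nonempty.
\<close>

definition generalized_KKM_map ::
    "'b::real_vector set \<Rightarrow> ('b \<Rightarrow> 'a set) \<Rightarrow> ('b \<Rightarrow> 'a set) \<Rightarrow> bool" where
  "generalized_KKM_map Y T H \<longleftrightarrow>
     (\<forall>B. finite B \<and> B \<subseteq> Y \<longrightarrow> (\<Union>y\<in>convex hull B. T y) \<subseteq> (\<Union>y\<in>B. H y))"

definition has_fip :: "'a set set \<Rightarrow> bool" where
  "has_fip \<F> \<longleftrightarrow> (\<forall>\<G>. finite \<G> \<and> \<G> \<subseteq> \<F> \<longrightarrow> \<Inter>\<G> \<noteq> {})"

definition KKM :: "'b::real_vector set \<Rightarrow> ('b \<Rightarrow> 'a::topological_space set) set" where
  "KKM Y = {T. \<forall>H. generalized_KKM_map Y T H \<longrightarrow> has_fip ((\<lambda>y. closure (H y)) ` Y)}"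

definition compact_correspondence ::
    "'b set \<Rightarrow> ('b \<Rightarrow> 'a::topological_space set) \<Rightarrow> bool" where
  "compact_correspondence Y T \<longleftrightarrow> compact (closure (\<Union>y\<in>Y. T y))"

text \<open>Openness of subsets of \<open>Y\<close> is relative to the subspace topology of \<open>Y\<close>.\<close>

definition lower_semicontinuous_into ::
    "'b::topological_space set \<Rightarrow> ('a::topological_space \<Rightarrow> 'b set) \<Rightarrow> bool" where
  "lower_semicontinuous_into Y P \<longleftrightarrow>
     (\<forall>V. openin (top_of_set Y) V \<longrightarrow> open {x. P x \<inter> V \<noteq> {}})"

definition open_valued_on ::
    "'b::topological_space set \<Rightarrow> ('b \<Rightarrow> 'b set) \<Rightarrow> bool" where
  "open_valued_on Y Q \<longleftrightarrow> (\<forall>y\<in>Y. openin (top_of_set Y) (Q y))"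

end

theory Submission imports Defs begin

text \<open>
  For \<open>y \<in> Y\<close> put \<open>F y = {x. P x \<inter> Q y = {}}\<close>. A finite set \<open>B \<subseteq> Y\<close> for which the
  inclusion \<open>T (co B) \<subseteq> F (B)\<close> fails is exactly what the theorem asks for: a point
  \<open>x \<in> T y\<close> with \<open>y \<in> co B\<close> lying in no \<open>F b\<close> satisfies \<open>P x \<inter> Q b \<noteq> {}\<close> for every \<open>b \<in> B\<close>.
  So it is enough that \<open>F\<close> is not a generalized KKM map with respect to \<open>T\<close>.

  Lower semicontinuity of \<open>P\<close> and openness of the values of \<open>Q\<close> make each \<open>F y\<close> closed.
  If \<open>F\<close> were generalized KKM, the KKM property of \<open>T\<close> together with its compactness
  would give a point common to all the \<open>F y\<close>
  (\<open>generalized_KKM_map_closed_values_common_point\<close>). At such a point \<open>P x\<close> would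
  meet no \<open>Q y\<close>, against the covering hypothesis.

  The points \<open>y\<^sub>1, \<dots>, y\<^sub>n\<close> need not be distinct, so the requirement \<open>n \<ge> 2\<close> costs nothing:
  an enumeration of \<open>B\<close> may repeat a point (\<open>finite_nonempty_enumeration_ge_2\<close>).
\<close>

text \<open>
  The finite intersection property supplied by the KKM property concerns the whole space,
  where it says nothing about infinite intersections. Shrinking \<open>F\<close> to the compact set
  \<open>K = closure (T (Y))\<close> keeps it generalized KKM, because \<open>co B \<subseteq> Y\<close> puts \<open>T (co B)\<close>
  inside \<open>K\<close>; for the shrunken map compactness turns finite intersections into the full one.
\<close>

lemma generalized_KKM_map_closed_values_common_point:
  fixes Y :: "'b::real_vector set"
    and T F :: "'b \<Rightarrow> 'a::topological_space set"
  assumes "convex Y" and "Y \<noteq> {}"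
    and KKM: "T \<in> KKM Y"
    and cpt: "compact_correspondence Y T"
    and cl: "\<And>y. y \<in> Y \<Longrightarrow> closed (F y)"
    and gen: "generalized_KKM_map Y T F"
  shows "(\<Inter>y\<in>Y. F y) \<noteq> {}"
proof
  assume empty: "(\<Inter>y\<in>Y. F y) = {}"
  define K where "K = closure (\<Union>y\<in>Y. T y)"
  have "compact K"
    using cpt by (simp add: K_def compact_correspondence_def)
  have clK: "closed (F y \<inter> K)" if "y \<in> Y" for y
    using cl[OF that] by (simp add: K_def closed_Int)
  have "generalized_KKM_map Y T (\<lambda>y. F y \<inter> K)"
    unfolding generalized_KKM_map_def
  proof (intro allI impI)
    fix B assume B: "finite B \<and> B \<subseteq> Y"
    have "convex hull B \<subseteq> Y"
      using B \<open>convex Y\<close> by (simp add: hull_minimal)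
    then have "(\<Union>y\<in>convex hull B. T y) \<subseteq> K"
      unfolding K_def using closure_subset by fastforce
    moreover have "(\<Union>y\<in>convex hull B. T y) \<subseteq> (\<Union>y\<in>B. F y)"
      using gen B by (simp add: generalized_KKM_map_def)
    ultimately show "(\<Union>y\<in>convex hull B. T y) \<subseteq> (\<Union>y\<in>B. F y \<inter> K)"
      by blast
  qed
  then have fip: "has_fip ((\<lambda>y. closure (F y \<inter> K)) ` Y)"
    using KKM by (simp add: KKM_def)
  have "K \<subseteq> (\<Union>y\<in>Y. - F y)"
    using empty by blast
  moreover have "open (- F y)" if "y \<in> Y" for y
    using cl[OF that] by (simp add: open_Compl)
  ultimately obtain D where D: "D \<subseteq> Y" "finite D" "K \<subseteq> (\<Union>y\<in>D. - F y)"
    using compactE_image[OF \<open>compact K\<close>, of Y "\<lambda>y. - F y"] by blast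
  obtain y0 where "y0 \<in> Y"
    using \<open>Y \<noteq> {}\<close> by blast
  \<comment> \<open>The finite subcover may be empty when \<open>K\<close> is; the extra index \<open>y0\<close> then keeps
      the intersection from being the whole space.\<close>
  have "finite ((\<lambda>y. closure (F y \<inter> K)) ` insert y0 D)"
    and "(\<lambda>y. closure (F y \<inter> K)) ` insert y0 D \<subseteq> (\<lambda>y. closure (F y \<inter> K)) ` Y"
    using D \<open>y0 \<in> Y\<close> by auto
  with fip have "(\<Inter>y\<in>insert y0 D. closure (F y \<inter> K)) \<noteq> {}"
    unfolding has_fip_def by blast
  moreover have "(\<Inter>y\<in>insert y0 D. closure (F y \<inter> K)) = (\<Inter>y\<in>insert y0 D. F y \<inter> K)"
    using D(1) \<open>y0 \<in> Y\<close> clK by (intro INF_cong refl closure_closed) auto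
  ultimately obtain x where "\<forall>y\<in>insert y0 D. x \<in> F y \<inter> K"
    by blast
  then show False
    using D(3) by blast
qed

lemma finite_nonempty_enumeration_ge_2:
  assumes "finite B" and "B \<noteq> {}"
  obtains n :: nat and ys where "n \<ge> 2" and "ys ` {1..n} = B"
proof -
  obtain h where "bij_betw h {1..card B} B"
    using ex_bij_betw_nat_finite_1[OF \<open>finite B\<close>] by blast
  then have h: "h ` {1..card B} = B"
    by (simp add: bij_betw_def)
  have "card B \<ge> 1"
    using assms by (simp add: Suc_leI card_gt_0_iff)
  then have "h 1 \<in> B"
    using h by auto
  \<comment> \<open>Listing one point twice makes the length at least 2 even for a singleton.\<close>
  have "(h(Suc (card B) := h 1)) ` {1..card B} = h ` {1..card B}"
    by (rule image_cong) auto
  then have "(h(Suc (card B) := h 1)) ` insert (Suc (card B)) {1..card B} = B"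
    using h \<open>h 1 \<in> B\<close> by (simp only: image_insert fun_upd_same insert_absorb)
  then have "(h(Suc (card B) := h 1)) ` {1..Suc (card B)} = B"
    by (simp add: atLeastAtMostSuc_conv del: image_insert)
  then show thesis
    using that[of "Suc (card B)"] \<open>card B \<ge> 1\<close> by (metis Suc_le_mono Suc_1 One_nat_def)
qed

theorem theorem5:
  fixes Y :: "'b::real_topological_vector set"
    and T :: "'b \<Rightarrow> 'a::topological_space set"
    and P :: "'a \<Rightarrow> 'b set"
    and Q :: "'b \<Rightarrow> 'b set"
  assumes "convex Y"
    and "T \<in> KKM Y"
    and "compact_correspondence Y T"
    and "\<And>x. P x \<subseteq> Y"
    and "\<And>x. P x \<noteq> {}"
    and "lower_semicontinuous_into Y P"
    and "\<And>y. y \<in> Y \<Longrightarrow> Q y \<subseteq> Y"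
    and "open_valued_on Y Q"
    and "\<And>x. \<exists>y\<in>Y. P x \<inter> Q y \<noteq> {}"
  shows "\<exists>n\<ge>2. \<exists>ys :: nat \<Rightarrow> 'b. (\<forall>i\<in>{1..n}. ys i \<in> Y) \<and>
           (\<exists>y \<in> convex hull (ys ` {1..n}). \<exists>x \<in> T y.
              \<forall>i\<in>{1..n}. Q (ys i) \<inter> P x \<noteq> {})"
proof -
  define F where "F y = {x. P x \<inter> Q y = {}}" for y
  have closed_F: "closed (F y)" if "y \<in> Y" for y
  proof -
    have "open {x. P x \<inter> Q y \<noteq> {}}"
      using assms(6,8) that by (simp add: lower_semicontinuous_into_def open_valued_on_def)
    moreover have "{x. P x \<inter> Q y \<noteq> {}} = - F y"
      by (auto simp: F_def)
    ultimately show ?thesis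
      by (simp add: closed_def)
  qed
  have "Y \<noteq> {}"
    using assms(9) by blast
  moreover have "(\<Inter>y\<in>Y. F y) = {}"
    using assms(9) by (auto simp: F_def)
  ultimately have "\<not> generalized_KKM_map Y T F"
    using generalized_KKM_map_closed_values_common_point[of Y T F] assms(1-3) closed_F
    by blast
  then obtain B y x where B: "finite B" "B \<subseteq> Y"
    and y: "y \<in> convex hull B" and x: "x \<in> T y" "x \<notin> (\<Union>b\<in>B. F b)"
    unfolding generalized_KKM_map_def by blast
  have "B \<noteq> {}"
    using y by auto
  then obtain n ys where n: "n \<ge> (2::nat)" and ys: "ys ` {1..n} = B"
    using finite_nonempty_enumeration_ge_2 B(1) by metis
  have "\<forall>i\<in>{1..n}. ys i \<in> Y"
    using ys B(2) by blast
  moreover have "\<forall>i\<in>{1..n}. Q (ys i) \<inter> P x \<noteq> {}"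
    using x(2) unfolding ys[symmetric] by (auto simp: F_def)
  ultimately show ?thesis
    using n y x(1) ys by blast
qed

end
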